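(* For every $\epsilon>0$ and all integers $p$ sufficiently large (depending on $\epsilon$), $HD_2(p,3)=\Omega\left(p^{\frac54-\epsilon}\right)$.
   Context: For integers $p\ge q\ge 1$, a family of sets $\mathcal F$ satisfies the $(p,q)$-property if for every subset $\mathcal F'\subseteq\mathcal F$ with $|\mathcal F'|\ge p$ there exist $q$ (distinct) elements of $\mathcal F'$ with nonempty common intersection. The family $\mathcal F$ is pierced by a set $P$ if for every $F\in\mathcal F$ there exists $x\in P$ with $x\in F$. For $p\ge q\ge d+1$, the Hadwiger-Debrunner number $HD_d(p,q)$ is the smallest value $c$ such that every finite family of convex sets in $\mathbb R^d$ with the $(p,q)$-property can be pierced by a set of at most $c$ points of $\mathbb R^d$ (it is finite by a theorem of Alon and Kleitman). The notation $X=\Omega(Y)$, for positive quantities, means $X\ge cY$ for some absolute constant $c>0$. *)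

theory Defs
  imports "HOL-Analysis.Analysis"
begin

(* For p >= 1 the condition "p \<le> card F'" entails that F' is finite; infinite subfamilies
   need no separate clause, since they contain finite ones with p members. *)
definition pq_property :: "nat \<Rightarrow> nat \<Rightarrow> 'a set set \<Rightarrow> bool" where
  "pq_property p q F \<longleftrightarrow>
     (\<forall>F'\<subseteq>F. p \<le> card F' \<longrightarrow> (\<exists>G\<subseteq>F'. card G = q \<and> \<Inter>G \<noteq> {}))"

definition pierces :: "'a set \<Rightarrow> 'a set set \<Rightarrow> bool" where
  "pierces P F \<longleftrightarrow> (\<forall>A\<in>F. \<exists>x\<in>P. x \<in> A)"

(* The ambient space is passed as a type argument; HD_d(p,q) is hadwiger_debrunner TYPE(real^'d) p q,
   meaningful for p >= q >= d + 1.
   The members of F must be nonempty: no set pierces a family containing the empty set, yet such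
   a family can have the (p,q)-property, e.g. {{}} for p >= 2.
   The value is in enat so that the definition does not presuppose the Alon-Kleitman theorem;
   it is the least admissible c if there is one, and infinity otherwise. *)
definition hadwiger_debrunner :: "'a::euclidean_space itself \<Rightarrow> nat \<Rightarrow> nat \<Rightarrow> enat" where
  "hadwiger_debrunner (_ :: 'a itself) p q =
     Inf (enat ` {c. \<forall>F :: 'a set set.
       finite F \<and> (\<forall>A\<in>F. convex A \<and> A \<noteq> {}) \<and> pq_property p q F \<longrightarrow>
       (\<exists>P. finite P \<and> card P \<le> c \<and> pierces P F)})"

end

theory Submission
  imports Defs "HOL-Real_Asymp.Real_Asymp"
begin

text \<open>
  The family that is hard to pierce consists of lines. By duality it is described by a set of
  \<open>N\<close> points: if no non-vertical line carries more than \<open>k\<close> of the points, then no point of the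
  plane lies on more than \<open>k\<close> of the dual lines, so piercing takes at least \<open>N / k\<close> points; and
  if among any \<open>p\<close> of the points three lie on a non-vertical line, then the dual lines have the
  \<open>(p, 3)\<close>-property. Vertical lines do not matter, since points on a vertical line have parallel
  duals. It remains to find such points with \<open>k\<close> constant and \<open>N\<close> about \<open>p powr (5 / 4)\<close>.

  They are a random sample of the narrow integer grid \<open>{0..<K} \<times> {0..<B}\<close>, where \<open>K\<close> is about
  \<open>N powr (1 / 5)\<close> and \<open>B\<close> exceeds \<open>N\<close> by a factor that is a small power of \<open>N\<close>. A non-vertical line carries at
  most \<open>K\<close> of the \<open>K * B\<close> grid points, hence on average \<open>N / B\<close> sampled points, which is a small
  negative power of \<open>N\<close>. As there are only polynomially many lines, a union bound makes all of
  them carry fewer than a constant number of sampled points.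

  A union bound over all \<open>p\<close>-sets without a collinear triple fails, because there are far too
  many of them. The method of hypergraph containers groups them: every grid set without three
  points on a line of integer slope lies in one of at most \<open>(K * B + 1) ^ q\<close> containers, each with
  at most \<open>9 * B\<close> points (theorem \<open>containers\<close>). A container is a fraction \<open>9 / K\<close> of the grid,
  so it receives about \<open>9 * N / K\<close> sampled points, and the probability that it receives \<open>p\<close>
  of them is exponentially small in \<open>p\<close> when \<open>p\<close> is somewhat larger than that. The union bound
  over the containers therefore works as soon as \<open>p\<close> exceeds both \<open>N / K\<close> and \<open>q\<close> by a small power
  of \<open>N\<close>. The container theorem gives \<open>q\<close> of order \<open>K powr (3 / 2) * B powr (1 / 2)\<close>, so the
  two requirements balance at \<open>K = N powr (1 / 5)\<close>, which yields \<open>p\<close> about \<open>N powr (4 / 5)\<close>.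

  The input of the container theorem is supersaturation
  (lemma \<open>many_grid_collinear_triples\<close>): at most \<open>2 * B\<close> lines of a given slope \<open>j < B / K\<close>
  meet the grid, so in a set of more than \<open>8 * B\<close> grid points, for each such slope, at least half
  of the points share their line with two others.
\<close>

section \<open>Containers for dense triple systems\<close>

lemma card_edges_remove:
  fixes G :: "('a \<times> 'a) set"
  assumes fin: "finite U" and sym: "sym G" and W: "W \<subseteq> U"
    and deg: "\<And>y. y \<in> W \<Longrightarrow> card (G `` {y} \<inter> U) \<le> E"
  shows "card (G \<inter> U \<times> U) \<le> card (G \<inter> (U - W) \<times> (U - W)) + 2 * E * card W"
proof -
  \<comment> \<open>The lost pairs have their first or, by symmetry, their second component in W.\<close>
  let ?S = "Sigma W (\<lambda>y. G `` {y} \<inter> U)"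
  have finW: "finite W" using W fin finite_subset by blast
  have finS: "finite ?S" using finW fin by auto
  have "card ?S = (\<Sum>y\<in>W. card (G `` {y} \<inter> U))"
    using finW fin by (simp add: card_SigmaI)
  also have "\<dots> \<le> (\<Sum>y\<in>W. E)" by (rule sum_mono) (rule deg)
  finally have S: "card ?S \<le> E * card W" by (simp add: mult.commute)
  have "G \<inter> U \<times> U \<subseteq> (G \<inter> (U - W) \<times> (U - W)) \<union> (?S \<union> ?S\<inverse>)"
    using sym by (auto dest: symD)
  hence "card (G \<inter> U \<times> U) \<le> card ((G \<inter> (U - W) \<times> (U - W)) \<union> (?S \<union> ?S\<inverse>))"
    using fin finS by (intro card_mono) auto
  also have "\<dots> \<le> card (G \<inter> (U - W) \<times> (U - W)) + card (?S \<union> ?S\<inverse>)"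
    by (rule card_Un_le)
  also have "card (?S \<union> ?S\<inverse>) \<le> card ?S + card (?S\<inverse>)" by (rule card_Un_le)
  finally show ?thesis using S by simp
qed

text \<open>
  The triple system \<open>H\<close> is spread out in the sense that a pair lies in at most \<open>\<Delta>\<close> triples, and
  every set of more than \<open>R\<close> vertices spans many triples. The lower bound \<open>(d + D * \<Delta>) * card U\<close>
  is what remains useful after pairs have been excluded: a graph on \<open>U\<close> of maximum degree \<open>D\<close>
  spoils at most \<open>D * \<Delta> * card U\<close> ordered triples, so some vertex still has at least \<open>d\<close> unspoilt
  pairs in its link.
\<close>

locale dense_triple_system =
  fixes V :: "'a set" and H :: "'a \<Rightarrow> 'a \<Rightarrow> 'a \<Rightarrow> bool"
    and R D \<Delta> :: nat and d :: real
  assumes finV: "finite V"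
    and swap12: "H x y z \<Longrightarrow> H y x z"
    and swap23: "H x y z \<Longrightarrow> H x z y"
    and codegree: "\<lbrakk>x \<in> V; y \<in> V\<rbrakk> \<Longrightarrow> card {z \<in> V. H x y z} \<le> \<Delta>"
    and dense: "\<lbrakk>U \<subseteq> V; R < card U\<rbrakk> \<Longrightarrow>
      (d + D * \<Delta>) * card U \<le> card {(x, y, z). x \<in> U \<and> y \<in> U \<and> z \<in> U \<and> H x y z}"
    and D_pos: "0 < D" and d_pos: "0 < d"
begin

definition independent :: "'a set \<Rightarrow> bool" where
  "independent I \<longleftrightarrow> (\<forall>x\<in>I. \<forall>y\<in>I. \<forall>z\<in>I. \<not> H x y z)"

definition link :: "'a \<Rightarrow> ('a \<times> 'a) set" where
  "link x = {(y, z). H x y z}"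

text \<open>
  The containers come from an algorithm that determines an independent set \<open>I\<close> by queries
  ``is the vertex \<open>x\<close> in \<open>I\<close>?''. Its state consists of a set \<open>U\<close> of vertices that may still be
  in \<open>I\<close> and a graph \<open>G\<close> of pairs that cannot both be in \<open>I\<close>, being in the link of a vertex known
  to lie in \<open>I\<close>. Only positive answers are costly, and the potential bounds their number: such an
  answer removes at least \<open>D\<close> vertices from \<open>U\<close> or adds at least \<open>d\<close> ordered pairs to \<open>G\<close>. The term
  \<open>2 * (D + \<Delta>) * card U\<close> pays for the edges that \<open>G\<close> loses when vertices are removed.
\<close>

definition potential :: "'a set \<Rightarrow> ('a \<times> 'a) set \<Rightarrow> real" where
  "potential U G = card U / D + (2 * (D + \<Delta>) * real (card U) - real (card (G \<inter> U \<times> U))) / d"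

definition admissible :: "'a set \<Rightarrow> ('a \<times> 'a) set \<Rightarrow> bool" where
  "admissible U G \<longleftrightarrow> U \<subseteq> V \<and> sym G \<and> (\<forall>y\<in>U. card (G `` {y} \<inter> U) \<le> D + \<Delta>)"

lemma link_sym: "sym (link x)"
  using swap23 by (auto simp: link_def sym_def)

lemma finite_subset_V: "U \<subseteq> V \<Longrightarrow> finite U"
  using finV finite_subset by blast

lemma admissible_subset:
  assumes "admissible U G" "W \<subseteq> U" shows "admissible W G"
proof -
  have "card (G `` {y} \<inter> W) \<le> D + \<Delta>" if "y \<in> W" for y
  proof -
    have "card (G `` {y} \<inter> W) \<le> card (G `` {y} \<inter> U)"
      using assms finite_subset_V by (intro card_mono) (auto simp: admissible_def)
    also have "\<dots> \<le> D + \<Delta>" using assms that by (auto simp: admissible_def)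
    finally show ?thesis .
  qed
  thus ?thesis using assms by (auto simp: admissible_def)
qed

lemma potential_nonneg:
  assumes "admissible U G" shows "0 \<le> potential U G"
proof -
  have fin: "finite U" using assms finite_subset_V by (auto simp: admissible_def)
  have "card (G \<inter> U \<times> U) \<le> card (G \<inter> (U - U) \<times> (U - U)) + 2 * (D + \<Delta>) * card U"
    using assms fin by (intro card_edges_remove) (auto simp: admissible_def)
  hence "real (card (G \<inter> U \<times> U)) \<le> real (2 * (D + \<Delta>) * card U)"
    by (intro of_nat_mono) simp
  thus ?thesis using d_pos by (auto simp: potential_def)
qed

lemma potential_remove:
  assumes "admissible U G" "W \<subseteq> U"
  shows "potential (U - W) G + card W / D \<le> potential U G"
proof -
  have fin: "finite U" using assms finite_subset_V by (auto simp: admissible_def)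
  have W: "finite W" "card (U - W) = card U - card W" "card W \<le> card U"
    using fin assms by (auto simp: card_Diff_subset finite_subset card_mono)
  have "card (G \<inter> U \<times> U) \<le> card (G \<inter> (U - W) \<times> (U - W)) + 2 * (D + \<Delta>) * card W"
    using assms fin by (intro card_edges_remove) (auto simp: admissible_def)
  hence "real (card (G \<inter> U \<times> U)) \<le> real (card (G \<inter> (U - W) \<times> (U - W)) + 2 * (D + \<Delta>) * card W)"
    by (rule of_nat_mono)
  hence "2 * (D + \<Delta>) * real (card U - card W) - card (G \<inter> (U - W) \<times> (U - W))
       \<le> 2 * (D + \<Delta>) * real (card U) - card (G \<inter> U \<times> U)"
    using W by (simp add: of_nat_diff algebra_simps)
  hence "(2 * (D + \<Delta>) * real (card (U - W)) - card (G \<inter> (U - W) \<times> (U - W))) / d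
       \<le> (2 * (D + \<Delta>) * real (card U) - card (G \<inter> U \<times> U)) / d"
    using d_pos W by (intro divide_right_mono) auto
  moreover have "card (U - W) / D + card W / D = card U / D"
    using W by (simp add: of_nat_diff add_divide_distrib[symmetric])
  ultimately show ?thesis unfolding potential_def by simp
qed

lemma vertex_with_many_new_pairs:
  assumes U: "U \<subseteq> V" "R < card U" and G: "\<And>y. y \<in> U \<Longrightarrow> card (G `` {y} \<inter> U) \<le> D"
  shows "\<exists>x\<in>U. d \<le> card ((link x - G) \<inter> U \<times> U)"
proof (rule ccontr)
  assume neg: "\<not> ?thesis"
  have fin: "finite U" using U finite_subset_V by blast
  let ?T = "{(x, y, z). x \<in> U \<and> y \<in> U \<and> z \<in> U \<and> H x y z}"
  let ?A = "Sigma U (\<lambda>x. (link x - G) \<inter> U \<times> U)"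
  let ?GU = "Sigma U (\<lambda>y. G `` {y} \<inter> U)"
  let ?B = "Sigma ?GU (\<lambda>(y, z). {x \<in> U. H y z x})"
  have finGU: "finite ?GU" using fin by auto
  have "card ?A = (\<Sum>x\<in>U. card ((link x - G) \<inter> U \<times> U))"
    using fin by (simp add: card_SigmaI)
  hence "real (card ?A) = (\<Sum>x\<in>U. real (card ((link x - G) \<inter> U \<times> U)))" by simp
  also have "\<dots> < (\<Sum>x\<in>U. d)"
    using neg U fin by (intro sum_strict_mono) auto
  finally have A: "real (card ?A) < d * card U" by (simp add: mult.commute)
  have "card ?GU = (\<Sum>y\<in>U. card (G `` {y} \<inter> U))" using fin by (simp add: card_SigmaI)
  also have "\<dots> \<le> (\<Sum>y\<in>U. D)" by (rule sum_mono) (rule G)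
  finally have GU: "card ?GU \<le> D * card U" by (simp add: mult.commute)
  have "card ?B = (\<Sum>e\<in>?GU. card (case e of (y, z) \<Rightarrow> {x \<in> U. H y z x}))"
    using finGU fin by (intro card_SigmaI) auto
  also have "\<dots> \<le> (\<Sum>e\<in>?GU. \<Delta>)"
  proof (rule sum_mono)
    fix e assume e: "e \<in> ?GU"
    obtain y z where yz: "e = (y, z)" by fastforce
    have "card {x \<in> U. H y z x} \<le> card {x \<in> V. H y z x}"
      using U finV by (intro card_mono) auto
    also have "\<dots> \<le> \<Delta>" using codegree e yz U by auto
    finally show "card (case e of (y, z) \<Rightarrow> {x \<in> U. H y z x}) \<le> \<Delta>" using yz by simp
  qed
  also have "\<dots> \<le> \<Delta> * (D * card U)" using GU by simp
  finally have B: "card ?B \<le> D * \<Delta> * card U" by (simp add: algebra_simps)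
  have "?T \<subseteq> ?A \<union> (\<lambda>((y, z), x). (x, y, z)) ` ?B"
  proof
    fix t assume "t \<in> ?T"
    then obtain x y z where t: "t = (x, y, z)" "x \<in> U" "y \<in> U" "z \<in> U" "H x y z" by auto
    show "t \<in> ?A \<union> (\<lambda>((y, z), x). (x, y, z)) ` ?B"
    proof (cases "(y, z) \<in> G")
      case True
      have "H y z x" using t swap12 swap23 by blast
      hence "((y, z), x) \<in> ?B" using True t by auto
      thus ?thesis using t by force
    next
      case False thus ?thesis using t by (auto simp: link_def)
    qed
  qed
  moreover have finB: "finite ?B" using finGU fin by (intro finite_SigmaI) auto
  moreover have "finite ?A" using fin by auto
  ultimately have "card ?T \<le> card (?A \<union> (\<lambda>((y, z), x). (x, y, z)) ` ?B)"
    by (intro card_mono) auto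
  also have "\<dots> \<le> card ?A + card ((\<lambda>((y, z), x). (x, y, z)) ` ?B)" by (rule card_Un_le)
  also have "\<dots> \<le> card ?A + card ?B" using card_image_le[OF finB] by simp
  finally have "real (card ?T) \<le> real (card ?A + card ?B)" by (rule of_nat_mono)
  also have "\<dots> < d * card U + real (D * \<Delta> * card U)"
    using A of_nat_mono[OF B, where 'a=real] by linarith
  finally show False using dense[OF U] by (simp add: algebra_simps)
qed

text \<open>
  The choice of the next query. If some vertex has degree at least \<open>D\<close> in \<open>G\<close>, asking for it is
  profitable: when it lies in \<open>I\<close>, all its neighbours can be discarded. Otherwise \<open>G\<close> is sparse,
  and a vertex with many new pairs in its link is chosen, so that \<open>G\<close> grows.
\<close>

lemma container_step:
  assumes adm: "admissible U G" and big: "R < card U"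
  shows "\<exists>x\<in>U. \<exists>U' G'. U' \<subseteq> U - {x} \<and> admissible U' G' \<and>
    potential U' G' + 1 \<le> potential U G \<and>
    (\<forall>I. I \<subseteq> U \<and> x \<in> I \<and> independent I \<and> G \<inter> I \<times> I = {} \<longrightarrow>
         I - {x} \<subseteq> U' \<and> G' \<inter> (I - {x}) \<times> (I - {x}) = {})"
proof (cases "\<exists>x\<in>U. D \<le> card (G `` {x} \<inter> U)")
  case True
  then obtain x where x: "x \<in> U" "D \<le> card (G `` {x} \<inter> U)" by blast
  let ?W = "insert x (G `` {x} \<inter> U)"
  have fin: "finite U" using adm finite_subset_V by (auto simp: admissible_def)
  have W: "?W \<subseteq> U" using x by auto
  have "D \<le> card ?W" using x(2) fin card_mono[of ?W "G `` {x} \<inter> U"] by fastforce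
  hence "1 \<le> card ?W / D" using D_pos by simp
  hence "potential (U - ?W) G + 1 \<le> potential U G"
    using potential_remove[OF adm W] by linarith
  moreover have "admissible (U - ?W) G" using admissible_subset[OF adm] by blast
  ultimately show ?thesis using x(1) by (intro bexI[of _ x] exI[of _ "U - ?W"] exI[of _ G]) auto
next
  case False
  have U: "U \<subseteq> V" using adm by (auto simp: admissible_def)
  have fin: "finite U" using U finite_subset_V by blast
  obtain x where x: "x \<in> U" "d \<le> card ((link x - G) \<inter> U \<times> U)"
    using vertex_with_many_new_pairs[OF U big, of G] False by force
  let ?G = "G \<union> link x"
  have adm': "admissible U ?G"
    unfolding admissible_def
  proof (intro conjI ballI U)
    show "sym ?G" using adm link_sym by (auto simp: admissible_def intro: sym_Un)
    fix y assume y: "y \<in> U"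
    have "card (link x `` {y} \<inter> U) \<le> card {z \<in> V. H x y z}"
      using U finV by (intro card_mono) (auto simp: link_def)
    also have "\<dots> \<le> \<Delta>" using codegree x y U by auto
    finally have "card (link x `` {y} \<inter> U) \<le> \<Delta>" .
    moreover have "card (G `` {y} \<inter> U) \<le> D" using False y by force
    moreover have "?G `` {y} \<inter> U = (G `` {y} \<inter> U) \<union> (link x `` {y} \<inter> U)" by auto
    ultimately show "card (?G `` {y} \<inter> U) \<le> D + \<Delta>"
      using card_Un_le[of "G `` {y} \<inter> U" "link x `` {y} \<inter> U"] by simp
  qed
  have "?G \<inter> U \<times> U = (G \<inter> U \<times> U) \<union> ((link x - G) \<inter> U \<times> U)" by auto
  moreover have "card ((G \<inter> U \<times> U) \<union> ((link x - G) \<inter> U \<times> U))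
      = card (G \<inter> U \<times> U) + card ((link x - G) \<inter> U \<times> U)"
    using fin by (intro card_Un_disjoint) auto
  ultimately have "real (card (?G \<inter> U \<times> U)) \<ge> card (G \<inter> U \<times> U) + d" using x(2) by simp
  hence "(2 * (D + \<Delta>) * real (card U) - card (?G \<inter> U \<times> U)) / d
      \<le> (2 * (D + \<Delta>) * real (card U) - card (G \<inter> U \<times> U) - d) / d"
    using d_pos by (intro divide_right_mono) auto
  hence "potential U ?G + 1 \<le> potential U G"
    unfolding potential_def using d_pos by (simp add: diff_divide_distrib)
  moreover have "potential (U - {x}) ?G \<le> potential U ?G"
  proof -
    have "0 \<le> card {x} / real D" by simp
    moreover have "potential (U - {x}) ?G + card {x} / D \<le> potential U ?G"
      using potential_remove[OF adm', of "{x}"] x(1) by blast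
    ultimately show ?thesis by linarith
  qed
  ultimately have "potential (U - {x}) ?G + 1 \<le> potential U G" by simp
  moreover have "admissible (U - {x}) ?G" using admissible_subset[OF adm'] by blast
  moreover have "?G \<inter> (I - {x}) \<times> (I - {x}) = {}"
    if "x \<in> I" "independent I" "G \<inter> I \<times> I = {}" for I
    using that by (auto simp: independent_def link_def)
  ultimately show ?thesis using x(1)
    by (intro bexI[of _ x] exI[of _ "U - {x}"] exI[of _ ?G]) auto
qed

text \<open>
  The leaves of the decision tree, each joined with the positive answers on its path, are the
  containers. With \<open>n\<close> vertices left and at most \<open>q\<close> positive answers ahead, the number of leaves
  satisfies \<open>L n q \<le> L (n - 1) q + L (n - 1) (q - 1)\<close>, whence the bound \<open>(n + 1) ^ q\<close>.
\<close>

lemma containers_from_state: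
  assumes "admissible U G" "potential U G \<le> real q"
  shows "\<exists>\<C>. finite \<C> \<and> card \<C> \<le> (card U + 1) ^ q \<and> (\<forall>C\<in>\<C>. C \<subseteq> U \<and> card C \<le> R + q) \<and>
    (\<forall>I. I \<subseteq> U \<and> independent I \<and> G \<inter> I \<times> I = {} \<longrightarrow> (\<exists>C\<in>\<C>. I \<subseteq> C))"
  using assms
proof (induction "card U" arbitrary: U G q rule: less_induct)
  case less
  have fin: "finite U" using less.prems finite_subset_V by (auto simp: admissible_def)
  show ?case
  proof (cases "card U \<le> R")
    case True
    thus ?thesis by (intro exI[of _ "{U}"]) auto
  next
    case False
    obtain x U' G' where x: "x \<in> U" and U': "U' \<subseteq> U - {x}" "admissible U' G'"
      and pot: "potential U' G' + 1 \<le> potential U G"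
      and ind: "\<And>I. \<lbrakk>I \<subseteq> U; x \<in> I; independent I; G \<inter> I \<times> I = {}\<rbrakk> \<Longrightarrow>
         I - {x} \<subseteq> U' \<and> G' \<inter> (I - {x}) \<times> (I - {x}) = {}"
      using container_step[OF less.prems(1)] False by (metis not_le)
    have "1 \<le> real q" using pot potential_nonneg[OF U'(2)] less.prems by linarith
    then obtain r where q: "q = Suc r" by (cases q) auto
    let ?X = "U - {x}"
    have cX: "card ?X + 1 = card U" using x fin by (metis Suc_eq_plus1 card_Suc_Diff1)
    have cU': "card U' + 1 \<le> card U" using U' card_mono[of ?X U'] fin cX by simp
    have admX: "admissible ?X G" using admissible_subset[OF less.prems(1)] by blast
    have potX: "potential ?X G \<le> real q"
    proof -
      have "0 \<le> card {x} / real D" by simp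
      moreover have "potential ?X G + card {x} / D \<le> potential U G"
        using potential_remove[OF less.prems(1), of "{x}"] x by blast
      ultimately show ?thesis using less.prems(2) by linarith
    qed
    obtain \<A> where A: "finite \<A>" "card \<A> \<le> card U ^ q" "\<And>C. C \<in> \<A> \<Longrightarrow> C \<subseteq> ?X \<and> card C \<le> R + q"
        "\<And>I. \<lbrakk>I \<subseteq> ?X; independent I; G \<inter> I \<times> I = {}\<rbrakk> \<Longrightarrow> \<exists>C\<in>\<A>. I \<subseteq> C"
      using less.hyps[OF _ admX potX] cX by auto
    have "potential U' G' \<le> real r" using pot less.prems q by simp
    then obtain \<B> where B: "finite \<B>" "card \<B> \<le> (card U' + 1) ^ r"
        "\<And>C. C \<in> \<B> \<Longrightarrow> C \<subseteq> U' \<and> card C \<le> R + r"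
        "\<And>I. \<lbrakk>I \<subseteq> U'; independent I; G' \<inter> I \<times> I = {}\<rbrakk> \<Longrightarrow> \<exists>C\<in>\<B>. I \<subseteq> C"
      using less.hyps[OF _ U'(2), of r] cU' by auto
    let ?C = "\<A> \<union> insert x ` \<B>"
    have "card ?C \<le> card \<A> + card (insert x ` \<B>)" by (rule card_Un_le)
    also have "\<dots> \<le> card U ^ q + (card U' + 1) ^ r"
      using A(2) B(2) card_image_le[OF B(1), of "insert x"] by linarith
    also have "\<dots> \<le> card U ^ q + card U ^ r" using cU' by (simp add: power_mono)
    also have "\<dots> = card U ^ r * (card U + 1)" using q by simp
    also have "\<dots> \<le> (card U + 1) ^ r * (card U + 1)" by (intro mult_right_mono power_mono) auto
    finally have "card ?C \<le> (card U + 1) ^ q" using q by (simp add: mult.commute)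
    moreover have "C \<subseteq> U \<and> card C \<le> R + q" if "C \<in> ?C" for C
      using that
    proof
      assume "C \<in> \<A>" thus ?thesis using A(3) by blast
    next
      assume "C \<in> insert x ` \<B>"
      then obtain C' where C': "C' \<in> \<B>" "C = insert x C'" by blast
      have "card C \<le> Suc (card C')" unfolding C' by (rule card_insert_le_m1) auto
      thus ?thesis using B(3)[OF C'(1)] C' U' x q by auto
    qed
    moreover have "\<exists>C\<in>?C. I \<subseteq> C" if I: "I \<subseteq> U" "independent I" "G \<inter> I \<times> I = {}" for I
    proof (cases "x \<in> I")
      case True
      have "independent (I - {x})" using I by (auto simp: independent_def)
      then obtain C where "C \<in> \<B>" "I - {x} \<subseteq> C" using B(4) ind[OF I(1) True I(2,3)] by blast
      thus ?thesis by blast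
    next
      case False
      then obtain C where "C \<in> \<A>" "I \<subseteq> C" using A(4)[of I] I by blast
      thus ?thesis by blast
    qed
    ultimately show ?thesis using A(1) B(1) by (intro exI[of _ ?C]) auto
  qed
qed

theorem containers:
  assumes "card V / D + 2 * (D + \<Delta>) * card V / d \<le> real q"
  shows "\<exists>\<C>. finite \<C> \<and> card \<C> \<le> (card V + 1) ^ q \<and> (\<forall>C\<in>\<C>. C \<subseteq> V \<and> card C \<le> R + q) \<and>
    (\<forall>I\<subseteq>V. independent I \<longrightarrow> (\<exists>C\<in>\<C>. I \<subseteq> C))"
proof -
  have "admissible V {}" by (auto simp: admissible_def sym_def)
  moreover have "potential V {} \<le> real q" using assms by (simp add: potential_def)
  ultimately show ?thesis using containers_from_state[of V "{}" q] by auto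
qed

end

section \<open>Random samples\<close>

text \<open>
  Counting form of the estimate that \<open>N\<close> independent uniform points of \<open>V\<close> hit \<open>C\<close> at least \<open>m\<close>
  times with probability at most \<open>(N choose m) * (card C / card V) ^ m\<close>: choose \<open>m\<close> of the indices
  that hit \<open>C\<close>.
\<close>

lemma card_samples_hitting:
  assumes "finite V" "C \<subseteq> V"
  shows "card {f \<in> {..<N} \<rightarrow>\<^sub>E V. m \<le> card {i. i < N \<and> f i \<in> C}} * card V ^ m
    \<le> (N choose m) * card C ^ m * card V ^ N"
proof (cases "m \<le> N")
  case False
  have "card {i. i < N \<and> f i \<in> C} \<le> N" for f :: "nat \<Rightarrow> 'a"
    using card_mono[of "{..<N}" "{i. i < N \<and> f i \<in> C}"] by auto
  hence "{f \<in> {..<N} \<rightarrow>\<^sub>E V. m \<le> card {i. i < N \<and> f i \<in> C}} = {}"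
    using False by (auto dest: le_trans)
  thus ?thesis by (simp only: card.empty)
next
  case True
  define S where "S A = (\<Pi>\<^sub>E i\<in>{..<N}. if i \<in> A then C else V)" for A
  let ?As = "{A. A \<subseteq> {..<N} \<and> card A = m}"
  have finC: "finite C" using assms finite_subset by blast
  have finS: "finite (S A)" for A
    unfolding S_def using assms finC by (intro finite_PiE) auto
  have finAs: "finite ?As" by (rule finite_subset[of _ "Pow {..<N}"]) auto
  have cS: "card (S A) = card C ^ m * card V ^ (N - m)" if "A \<in> ?As" for A
  proof -
    have A: "A \<subseteq> {..<N}" "card A = m" using that by auto
    have "card (S A) = (\<Prod>i<N. card (if i \<in> A then C else V))"
      unfolding S_def by (simp add: card_PiE)
    also have "\<dots> = (\<Prod>i<N. if i \<in> A then card C else card V)"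
      by (rule prod.cong) auto
    also have "\<dots> = card C ^ card ({..<N} \<inter> A) * card V ^ card ({..<N} - A)"
      by (simp add: prod.If_cases Diff_eq Int_def)
    also have "{..<N} \<inter> A = A" using A by auto
    also have "card ({..<N} - A) = N - m" using A by (simp add: card_Diff_subset finite_subset)
    finally show ?thesis using A by simp
  qed
  have "{f \<in> {..<N} \<rightarrow>\<^sub>E V. m \<le> card {i. i < N \<and> f i \<in> C}} \<subseteq> (\<Union>A\<in>?As. S A)"
  proof
    fix f assume f: "f \<in> {f \<in> {..<N} \<rightarrow>\<^sub>E V. m \<le> card {i. i < N \<and> f i \<in> C}}"
    hence "m \<le> card {i. i < N \<and> f i \<in> C}" by simp
    then obtain A where A: "A \<subseteq> {i. i < N \<and> f i \<in> C}" "card A = m"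
      using obtain_subset_with_card_n[of m "{i. i < N \<and> f i \<in> C}"] by auto
    have "f \<in> S A" using A f by (auto simp: S_def PiE_iff)
    thus "f \<in> (\<Union>A\<in>?As. S A)" using A by auto
  qed
  hence "card {f \<in> {..<N} \<rightarrow>\<^sub>E V. m \<le> card {i. i < N \<and> f i \<in> C}} \<le> card (\<Union>A\<in>?As. S A)"
    using finAs finS by (intro card_mono) auto
  also have "\<dots> \<le> (\<Sum>A\<in>?As. card (S A))" by (rule card_UN_le[OF finAs])
  also have "\<dots> = (\<Sum>A\<in>?As. card C ^ m * card V ^ (N - m))" by (rule sum.cong) (auto simp: cS)
  also have "\<dots> = (N choose m) * (card C ^ m * card V ^ (N - m))"
    using n_subsets[of "{..<N}" m] by simp
  finally have "card {f \<in> {..<N} \<rightarrow>\<^sub>E V. m \<le> card {i. i < N \<and> f i \<in> C}} * card V ^ m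
     \<le> (N choose m) * (card C ^ m * card V ^ (N - m)) * card V ^ m" by (rule mult_right_mono) simp
  also have "\<dots> = (N choose m) * card C ^ m * (card V ^ (N - m) * card V ^ m)"
    by (simp add: algebra_simps)
  also have "card V ^ (N - m) * card V ^ m = card V ^ N" using True by (simp flip: power_add)
  finally show ?thesis .
qed

lemma card_samples_hitting_family:
  assumes "finite V" "V \<noteq> {}" "finite \<C>" "\<And>C. C \<in> \<C> \<Longrightarrow> C \<subseteq> V \<and> card C \<le> c"
  shows "real (card {f \<in> {..<N} \<rightarrow>\<^sub>E V. \<exists>C\<in>\<C>. m \<le> card {i. i < N \<and> f i \<in> C}})
    \<le> card \<C> * ((N choose m) * (c / card V) ^ m) * card V ^ N"
proof -
  let ?B = "\<lambda>C. {f \<in> {..<N} \<rightarrow>\<^sub>E V. m \<le> card {i. i < N \<and> f i \<in> C}}"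
  have V: "0 < card V" using assms by (simp add: card_gt_0_iff)
  have B: "real (card (?B C)) \<le> (N choose m) * (c / card V) ^ m * card V ^ N" if "C \<in> \<C>" for C
  proof -
    have "card (?B C) * card V ^ m \<le> (N choose m) * card C ^ m * card V ^ N"
      using assms that by (intro card_samples_hitting) auto
    also have "\<dots> \<le> (N choose m) * c ^ m * card V ^ N"
      using assms that by (intro mult_right_mono mult_left_mono power_mono) auto
    finally have "real (card (?B C) * card V ^ m) \<le> real ((N choose m) * c ^ m * card V ^ N)"
      by (rule of_nat_mono)
    thus ?thesis using V by (simp add: power_divide field_simps)
  qed
  have eq: "{f \<in> {..<N} \<rightarrow>\<^sub>E V. \<exists>C\<in>\<C>. m \<le> card {i. i < N \<and> f i \<in> C}} = (\<Union>C\<in>\<C>. ?B C)" by auto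
  have "card {f \<in> {..<N} \<rightarrow>\<^sub>E V. \<exists>C\<in>\<C>. m \<le> card {i. i < N \<and> f i \<in> C}} \<le> (\<Sum>C\<in>\<C>. card (?B C))"
    unfolding eq by (rule card_UN_le[OF assms(3)])
  hence "real (card {f \<in> {..<N} \<rightarrow>\<^sub>E V. \<exists>C\<in>\<C>. m \<le> card {i. i < N \<and> f i \<in> C}}) \<le> real (\<Sum>C\<in>\<C>. card (?B C))"
    by (rule of_nat_mono)
  also have "\<dots> = (\<Sum>C\<in>\<C>. real (card (?B C)))" by simp
  also have "\<dots> \<le> (\<Sum>C\<in>\<C>. (N choose m) * (c / card V) ^ m * card V ^ N)" by (rule sum_mono) (rule B)
  also have "\<dots> = card \<C> * ((N choose m) * (c / card V) ^ m) * card V ^ N"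
    by (simp only: sum_constant mult.assoc)
  finally show ?thesis .
qed

lemma sample_avoiding_two_families:
  assumes V: "finite V" "V \<noteq> {}"
    and C: "finite \<C>" "\<And>C. C \<in> \<C> \<Longrightarrow> C \<subseteq> V \<and> card C \<le> c"
    and L: "finite \<L>" "\<And>L. L \<in> \<L> \<Longrightarrow> L \<subseteq> V \<and> card L \<le> l"
    and less: "card \<C> * ((N choose m) * (c / card V) ^ m)
             + card \<L> * ((N choose k) * (l / card V) ^ k) < 1"
  shows "\<exists>f\<in>{..<N} \<rightarrow> V. (\<forall>C\<in>\<C>. card {i. i < N \<and> f i \<in> C} < m) \<and>
                         (\<forall>L\<in>\<L>. card {i. i < N \<and> f i \<in> L} < k)"
proof (rule ccontr)
  assume neg: "\<not> ?thesis"
  let ?F = "{..<N} \<rightarrow>\<^sub>E V"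
  let ?A = "{f \<in> ?F. \<exists>C\<in>\<C>. m \<le> card {i. i < N \<and> f i \<in> C}}"
  let ?B = "{f \<in> ?F. \<exists>C\<in>\<L>. k \<le> card {i. i < N \<and> f i \<in> C}}"
  have finF: "finite ?F" using V by (intro finite_PiE) auto
  have "?F \<subseteq> ?A \<union> ?B"
  proof
    fix f assume f: "f \<in> ?F"
    hence "f \<in> {..<N} \<rightarrow> V" by auto
    thus "f \<in> ?A \<union> ?B" using neg f by (auto simp: not_less)
  qed
  hence "card ?F \<le> card (?A \<union> ?B)" using finF by (intro card_mono) auto
  also have "\<dots> \<le> card ?A + card ?B" by (rule card_Un_le)
  finally have "real (card ?F) \<le> real (card ?A + card ?B)" by (rule of_nat_mono)
  moreover have "real (card ?F) = real (card V ^ N)" by (simp add: card_PiE)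
  ultimately have "real (card V ^ N) \<le> real (card ?A) + real (card ?B)"
    by (simp only: of_nat_add)
  also have "\<dots> \<le> card \<C> * ((N choose m) * (c / card V) ^ m) * card V ^ N
             + card \<L> * ((N choose k) * (l / card V) ^ k) * card V ^ N"
    by (rule add_mono[OF card_samples_hitting_family[OF V C] card_samples_hitting_family[OF V L]])
  also have "\<dots> = (card \<C> * ((N choose m) * (c / card V) ^ m)
             + card \<L> * ((N choose k) * (l / card V) ^ k)) * card V ^ N"
    by (rule distrib_right[symmetric])
  also have "\<dots> < 1 * real (card V ^ N)"
    using less V by (intro mult_strict_right_mono) (auto simp: card_gt_0_iff)
  finally show False by simp
qed

section \<open>Collinear triples in a narrow grid\<close>

definition grid :: "nat \<Rightarrow> nat \<Rightarrow> (int \<times> int) set" where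
  "grid K B = {0..<int K} \<times> {0..<int B}"

definition intercept :: "nat \<Rightarrow> int \<times> int \<Rightarrow> int" where
  "intercept j v = snd v - int j * fst v"

text \<open>
  Only integer slopes in \<open>{0..<J}\<close> are considered: they already provide enough triples, and for
  them the lines meeting the grid are few and easily counted by their intercepts.
\<close>

definition grid_collinear :: "nat \<Rightarrow> int \<times> int \<Rightarrow> int \<times> int \<Rightarrow> int \<times> int \<Rightarrow> bool" where
  "grid_collinear J x y z \<longleftrightarrow> x \<noteq> y \<and> y \<noteq> z \<and> x \<noteq> z \<and>
     (\<exists>j<J. intercept j x = intercept j y \<and> intercept j y = intercept j z)"

lemma finite_grid: "finite (grid K B)" by (simp add: grid_def)

lemma card_grid: "card (grid K B) = K * B" by (simp add: grid_def card_cartesian_product)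

lemma intercept_eq_imp_eq:
  "intercept j v = intercept j w \<Longrightarrow> fst v = fst w \<Longrightarrow> v = w"
  by (simp add: intercept_def prod_eq_iff)

lemma slope_unique:
  assumes "v \<noteq> w" "intercept i v = intercept i w" "intercept j v = intercept j w"
  shows "i = j"
proof -
  have "(int i - int j) * (fst v - fst w) = 0"
    using assms(2,3) by (simp add: intercept_def algebra_simps)
  moreover have "fst v \<noteq> fst w" using assms intercept_eq_imp_eq by blast
  ultimately show ?thesis by simp
qed

lemma card_le_if_inj_on_fst:
  assumes "A \<subseteq> grid K B" "inj_on fst A" shows "card A \<le> K"
proof -
  have "fst ` A \<subseteq> {0..<int K}" using assms by (auto simp: grid_def)
  hence "card A \<le> card {0..<int K}" using assms by (intro card_inj_on_le) auto
  thus ?thesis by simp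
qed

lemma codegree_grid_collinear:
  "card {z \<in> grid K B. grid_collinear J x y z} \<le> K"
proof (intro card_le_if_inj_on_fst inj_onI)
  fix z z' assume z: "z \<in> {z \<in> grid K B. grid_collinear J x y z}"
    "z' \<in> {z \<in> grid K B. grid_collinear J x y z}" "fst z = fst z'"
  then obtain j j' where "x \<noteq> y" "intercept j x = intercept j y" "intercept j y = intercept j z"
    "intercept j' x = intercept j' y" "intercept j' y = intercept j' z'"
    by (auto simp: grid_collinear_def)
  moreover from this have "j = j'" using slope_unique by blast
  ultimately show "z = z'" using z intercept_eq_imp_eq by metis
qed auto

text \<open>
  For \<open>j < J\<close>, the intercepts of grid points lie in \<open>{- int B..<int B}\<close>, and each of these
  \<open>2 * B\<close> lines can account for at most two vertices that share it with at most one other.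
\<close>

lemma card_poor_vertices:
  assumes U: "U \<subseteq> grid K B" and j: "j < J" and JK: "J * K \<le> B"
  shows "card {v \<in> U. card {w \<in> U. intercept j w = intercept j v} \<le> 2} \<le> 4 * B"
proof -
  let ?P = "{v \<in> U. card {w \<in> U. intercept j w = intercept j v} \<le> 2}"
  let ?F = "\<lambda>c. {v \<in> ?P. intercept j v = c}"
  have fin: "finite U" using U finite_grid finite_subset by blast
  have "intercept j ` ?P \<subseteq> {- int B..<int B}"
  proof
    fix c assume "c \<in> intercept j ` ?P"
    then obtain v where v: "v \<in> grid K B" "c = intercept j v" using U by auto
    have "int j * fst v \<le> int J * int K" using v j by (intro mult_mono) (auto simp: grid_def)
    also have "\<dots> \<le> int B" using JK by (metis of_nat_le_iff of_nat_mult)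
    finally have "int j * fst v \<le> int B" .
    moreover have "0 \<le> int j * fst v" using v by (auto simp: grid_def)
    moreover have "0 \<le> snd v" "snd v < int B" using v by (auto simp: grid_def)
    ultimately show "c \<in> {- int B..<int B}"
      unfolding v(2) intercept_def atLeastLessThan_iff by linarith
  qed
  hence "card (intercept j ` ?P) \<le> card {- int B..<int B}" by (intro card_mono) auto
  hence im: "card (intercept j ` ?P) \<le> 2 * B" by simp
  have "?P = (\<Union>c\<in>intercept j ` ?P. ?F c)" by auto
  hence "card ?P = card (\<Union>c\<in>intercept j ` ?P. ?F c)" by (rule arg_cong)
  also have "\<dots> \<le> (\<Sum>c\<in>intercept j ` ?P. card (?F c))" using fin by (intro card_UN_le) auto
  also have "\<dots> \<le> (\<Sum>c\<in>intercept j ` ?P. 2)"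
  proof (rule sum_mono)
    fix c assume "c \<in> intercept j ` ?P"
    then obtain v where v: "v \<in> ?P" "c = intercept j v" by auto
    have "card (?F c) \<le> card {w \<in> U. intercept j w = intercept j v}"
      using fin v by (intro card_mono) auto
    thus "card (?F c) \<le> 2" using v by simp
  qed
  finally show ?thesis using im by simp
qed

text \<open>
  For each slope at least half of the vertices of \<open>U\<close> are rich, that is, their line of this
  slope contains two further vertices of \<open>U\<close>. Triples obtained from different slopes differ, because two points
  determine the slope.
\<close>

lemma many_grid_collinear_triples:
  assumes U: "U \<subseteq> grid K B" "8 * B < card U" and JK: "J * K \<le> B"
  shows "J * card U \<le> 2 * card {(x, y, z). x \<in> U \<and> y \<in> U \<and> z \<in> U \<and> grid_collinear J x y z}"
proof -
  let ?T = "{(x, y, z). x \<in> U \<and> y \<in> U \<and> z \<in> U \<and> grid_collinear J x y z}"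
  define rich where "rich j = {v \<in> U. 2 < card {w \<in> U. intercept j w = intercept j v}}" for j
  have fin: "finite U" using U finite_grid finite_subset by blast
  have finT: "finite ?T" by (rule finite_subset[of _ "U \<times> U \<times> U"]) (use fin in auto)
  have rich: "card U \<le> 2 * card (rich j)" if "j < J" for j
  proof -
    let ?P = "{v \<in> U. card {w \<in> U. intercept j w = intercept j v} \<le> 2}"
    \<comment> \<open>The poor vertices are fewer than half of U.\<close>
    have eq: "?P \<union> rich j = U" by (auto simp: rich_def)
    have "card U \<le> card ?P + card (rich j)" using card_Un_le[of ?P "rich j"] unfolding eq .
    thus ?thesis using card_poor_vertices[OF U(1) that JK] U(2) by linarith
  qed
  let ?Q = "\<lambda>(j, v) (x, y, z). (x, y, z) \<in> ?T \<and> x = v \<and> intercept j x = intercept j y"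
  have "\<exists>t. ?Q s t" if "s \<in> Sigma {..<J} rich" for s
  proof -
    obtain j v where s: "s = (j, v)" "j < J" "v \<in> rich j" using \<open>s \<in> Sigma {..<J} rich\<close> by auto
    let ?W = "{w \<in> U. intercept j w = intercept j v}"
    have v: "2 < card ?W" "v \<in> ?W" using s by (auto simp: rich_def)
    have "card (?W - {v}) = card ?W - 1" using v(2) by (rule card_Diff_singleton)
    hence "2 \<le> card (?W - {v})" using v(1) by linarith
    then obtain W where W: "W \<subseteq> ?W - {v}" "card W = 2" by (rule obtain_subset_with_card_n)
    then obtain y z where "W = {y, z}" "y \<noteq> z" by (auto simp: card_2_iff)
    hence "?Q s (v, y, z)" using W v s by (auto simp: grid_collinear_def)
    thus ?thesis by blast
  qed
  hence "\<forall>s\<in>Sigma {..<J} rich. \<exists>t. ?Q s t" by blast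
  then obtain g where g: "\<forall>s\<in>Sigma {..<J} rich. ?Q s (g s)" by (rule bchoice[THEN exE])
  have "inj_on g (Sigma {..<J} rich)"
  proof (rule inj_onI)
    fix s t assume st: "s \<in> Sigma {..<J} rich" "t \<in> Sigma {..<J} rich" "g s = g t"
    obtain i v where s: "s = (i, v)" by (cases s)
    obtain j w where t: "t = (j, w)" by (cases t)
    obtain x y z where xyz: "g s = (x, y, z)" by (cases "g s") auto
    have "x \<noteq> y" "x = v" "intercept i x = intercept i y"
      using bspec[OF g st(1)] s xyz by (auto simp: grid_collinear_def)
    moreover have "x = w" "intercept j x = intercept j y"
      using bspec[OF g st(2)] t xyz st(3) by auto
    ultimately show "s = t" using slope_unique[of x y i j] s t by simp
  qed
  moreover have "g ` Sigma {..<J} rich \<subseteq> ?T" using g by fastforce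
  ultimately have "card (Sigma {..<J} rich) \<le> card ?T" using finT by (intro card_inj_on_le)
  moreover have "card (Sigma {..<J} rich) = (\<Sum>j<J. card (rich j))"
    using fin by (intro card_SigmaI) (auto simp: rich_def)
  moreover have "(\<Sum>j<J. card U) \<le> (\<Sum>j<J. 2 * card (rich j))" by (rule sum_mono) (simp add: rich)
  ultimately show ?thesis by (simp add: sum_distrib_left[symmetric])
qed

lemma grid_dense_triple_system:
  assumes JK: "J * K \<le> B" and D: "0 < D" and d: "0 < d" "d + real D * K \<le> J / 2"
  shows "dense_triple_system (grid K B) (grid_collinear J) (8 * B) D K d"
proof
  show "finite (grid K B)" by (rule finite_grid)
  show "grid_collinear J y x z" if "grid_collinear J x y z" for x y z
    using that unfolding grid_collinear_def by metis
  show "grid_collinear J x z y" if "grid_collinear J x y z" for x y z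
    using that unfolding grid_collinear_def by metis
  show "card {z \<in> grid K B. grid_collinear J x y z} \<le> K" for x y
    by (rule codegree_grid_collinear)
  fix U assume U: "U \<subseteq> grid K B" "8 * B < card U"
  have "(d + D * K) * card U \<le> (J / 2) * card U" using d by (intro mult_right_mono) auto
  also have "\<dots> = real (J * card U) / 2" by simp
  also have "\<dots> \<le> real (2 * card {(x, y, z). x \<in> U \<and> y \<in> U \<and> z \<in> U \<and> grid_collinear J x y z}) / 2"
    by (intro divide_right_mono of_nat_mono many_grid_collinear_triples[OF U JK]) auto
  finally show "(d + real (D * K)) * card U
      \<le> card {(x, y, z). x \<in> U \<and> y \<in> U \<and> z \<in> U \<and> grid_collinear J x y z}" by simp
qed (fact D d)+

section \<open>Dual lines\<close>

text \<open>
  The dual of \<open>(a, b)\<close> is the line \<open>t = b - a * s\<close>. It contains \<open>(s, t)\<close> if and only if \<open>(a, b)\<close>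
  is on the line of slope \<open>s\<close> and intercept \<open>t\<close>, so a point of the plane corresponds to a
  non-vertical line through grid points.
\<close>

definition dual_line :: "int \<times> int \<Rightarrow> (real ^ 2) set" where
  "dual_line v = {z. z $ 2 = of_int (snd v) - of_int (fst v) * z $ 1}"

lemma vector_2_in_dual_line:
  "vector [s, t] \<in> dual_line v \<longleftrightarrow> t = of_int (snd v) - of_int (fst v) * s"
  by (simp add: dual_line_def)

lemma dual_line_nonempty: "dual_line v \<noteq> {}"
  using vector_2_in_dual_line[of 0 "of_int (snd v)" v] by auto

lemma convex_dual_line: "convex (dual_line v)"
proof -
  have "dual_line v = {z. (vector [of_int (fst v), 1] :: real ^ 2) \<bullet> z = of_int (snd v)}"
    by (auto simp: dual_line_def inner_vec_def sum_2 algebra_simps)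
  thus ?thesis by (simp add: convex_hyperplane)
qed

lemma dual_line_inj: "inj dual_line"
proof (rule injI)
  fix v w assume eq: "dual_line v = dual_line w"
  have "vector [0, of_int (snd v)] \<in> dual_line w" unfolding eq[symmetric] by (simp add: vector_2_in_dual_line)
  hence "snd v = snd w" by (simp add: vector_2_in_dual_line)
  moreover have "vector [1, of_int (snd v - fst v)] \<in> dual_line w"
    unfolding eq[symmetric] by (simp add: vector_2_in_dual_line)
  hence "snd v - fst v = snd w - fst w" unfolding vector_2_in_dual_line by linarith
  ultimately show "v = w" by (simp add: prod_eq_iff)
qed

lemma fst_eq_on_common_point:
  "z \<in> dual_line v \<Longrightarrow> z \<in> dual_line w \<Longrightarrow> fst v = fst w \<Longrightarrow> v = w"
  by (simp add: dual_line_def prod_eq_iff)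

lemma common_point_unique:
  assumes "v \<noteq> w" "z \<in> dual_line v" "z \<in> dual_line w" "z' \<in> dual_line v" "z' \<in> dual_line w"
  shows "z = z'"
proof -
  have "fst v \<noteq> fst w" using assms fst_eq_on_common_point by blast
  moreover have "(real_of_int (fst v) - of_int (fst w)) * (z $ 1 - z' $ 1) = 0"
    using assms(2-) by (simp add: dual_line_def algebra_simps)
  ultimately have "z $ 1 = z' $ 1" by simp
  thus ?thesis using assms(2,4) by (simp add: vec_eq_iff forall_2 dual_line_def)
qed

lemma grid_collinear_imp_concurrent:
  assumes "grid_collinear J x y w"
  shows "dual_line x \<inter> dual_line y \<inter> dual_line w \<noteq> {}"
proof -
  obtain j where j: "intercept j x = intercept j y" "intercept j y = intercept j w"
    using assms by (auto simp: grid_collinear_def)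
  have "vector [real j, of_int (intercept j y)] \<in> dual_line v" if "intercept j v = intercept j y" for v
    unfolding vector_2_in_dual_line that[symmetric] by (simp add: intercept_def)
  from this[of x] this[of y] this[of w] show ?thesis using j by auto
qed

text \<open>
  Seen from the grid, this is the set of points of \<open>V\<close> on one non-vertical line.
\<close>

definition pencil :: "(int \<times> int) set \<Rightarrow> real ^ 2 \<Rightarrow> (int \<times> int) set" where
  "pencil V z = {v \<in> V. z \<in> dual_line v}"

lemma card_pencil: "card (pencil (grid K B) z) \<le> K"
proof (intro card_le_if_inj_on_fst inj_onI)
  fix v w assume "v \<in> pencil (grid K B) z" "w \<in> pencil (grid K B) z" "fst v = fst w"
  thus "v = w" using fst_eq_on_common_point[of z v w] by (simp add: pencil_def)
qed (auto simp: pencil_def)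

text \<open>
  Two points determine the line through them, so there are at most as many pencils with two
  members as pairs of points.
\<close>

lemma card_pencils:
  fixes V :: "(int \<times> int) set"
  assumes "finite V"
  defines "\<L> \<equiv> {L \<in> range (pencil V). 2 \<le> card L}"
  shows "finite \<L>" "card \<L> \<le> card V ^ 2"
proof -
  have "\<exists>e. e \<in> V \<times> V \<and> fst e \<noteq> snd e \<and> fst e \<in> L \<and> snd e \<in> L" if "L \<in> \<L>" for L
  proof -
    have "2 \<le> card L" using that by (simp add: \<L>_def)
    then obtain W where W: "W \<subseteq> L" "card W = 2" by (rule obtain_subset_with_card_n)
    then obtain v w where "W = {v, w}" "v \<noteq> w" by (auto simp: card_2_iff)
    moreover have "L \<subseteq> V" using that by (auto simp: \<L>_def pencil_def)
    ultimately show ?thesis using W by (intro exI[of _ "(v, w)"]) auto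
  qed
  then obtain e where e: "\<And>L. L \<in> \<L> \<Longrightarrow> e L \<in> V \<times> V \<and> fst (e L) \<noteq> snd (e L) \<and> fst (e L) \<in> L \<and> snd (e L) \<in> L"
    by metis
  have inj: "inj_on e \<L>"
  proof (rule inj_onI)
    fix L M assume LM: "L \<in> \<L>" "M \<in> \<L>" "e L = e M"
    then obtain z z' where z: "L = pencil V z" "M = pencil V z'" by (auto simp: \<L>_def)
    have "z = z'"
      using e[OF LM(1)] e[OF LM(2)] z LM(3)
      by (intro common_point_unique[of "fst (e L)" "snd (e L)"]) (auto simp: pencil_def)
    thus "L = M" using z by simp
  qed
  have sub: "e ` \<L> \<subseteq> V \<times> V" using e by blast
  show "finite \<L>" using inj_on_finite[OF inj sub] assms by auto
  show "card \<L> \<le> card V ^ 2"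
    using card_inj_on_le[OF inj sub] assms by (simp add: card_cartesian_product power2_eq_square)
qed

text \<open>
  Multiplicities in the sample \<open>f\<close> do no harm: distinct points have distinct dual lines, so the
  \<open>(p, 3)\<close>-property concerns the image of \<open>f\<close>, whereas the piercing number is bounded by counting
  indices.
\<close>

lemma hadwiger_debrunner_ge:
  fixes f :: "nat \<Rightarrow> int \<times> int"
  assumes N: "m * k \<le> N" "0 < k"
    and dep: "\<And>S. \<lbrakk>S \<subseteq> f ` {..<N}; p \<le> card S\<rbrakk> \<Longrightarrow> \<exists>x\<in>S. \<exists>y\<in>S. \<exists>z\<in>S. grid_collinear J x y z"
    and deg: "\<And>z. card {i. i < N \<and> z \<in> dual_line (f i)} \<le> k"
  shows "enat m \<le> hadwiger_debrunner TYPE(real ^ 2) p 3"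
  unfolding hadwiger_debrunner_def
proof (rule INF_greatest, clarify)
  fix c assume c: "\<forall>F :: (real ^ 2) set set.
      finite F \<and> (\<forall>A\<in>F. convex A \<and> A \<noteq> {}) \<and> pq_property p 3 F \<longrightarrow>
      (\<exists>P. finite P \<and> card P \<le> c \<and> pierces P F)"
  let ?F = "dual_line ` f ` {..<N}"
  have "pq_property p 3 ?F"
    unfolding pq_property_def
  proof (intro allI impI)
    fix F' assume F': "F' \<subseteq> ?F" "p \<le> card F'"
    then obtain S where S: "S \<subseteq> f ` {..<N}" "F' = dual_line ` S" by (meson subset_imageE)
    have inj: "inj_on dual_line A" for A using dual_line_inj inj_on_subset by blast
    have "p \<le> card S" using F' S card_image[OF inj] by simp
    then obtain x y z where xyz: "x \<in> S" "y \<in> S" "z \<in> S" "grid_collinear J x y z" using dep[OF S(1)] by blast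
    have "card {x, y, z} = 3" using xyz(4) by (auto simp: grid_collinear_def)
    hence "card (dual_line ` {x, y, z}) = 3" using card_image[OF inj] by metis
    moreover have "\<Inter> (dual_line ` {x, y, z}) \<noteq> {}"
      using grid_collinear_imp_concurrent[OF xyz(4)] by (simp add: Int_assoc)
    moreover have "dual_line ` {x, y, z} \<subseteq> F'" using xyz S by auto
    ultimately show "\<exists>G\<subseteq>F'. card G = 3 \<and> \<Inter> G \<noteq> {}" by blast
  qed
  then obtain P where P: "finite P" "card P \<le> c" "pierces P ?F"
    using c[rule_format, of ?F] convex_dual_line dual_line_nonempty by auto
  have "{..<N} \<subseteq> (\<Union>z\<in>P. {i. i < N \<and> z \<in> dual_line (f i)})"
    using P(3) by (auto simp: pierces_def)
  hence "card {..<N} \<le> card (\<Union>z\<in>P. {i. i < N \<and> z \<in> dual_line (f i)})"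
    using P(1) by (intro card_mono) auto
  also have "\<dots> \<le> (\<Sum>z\<in>P. card {i. i < N \<and> z \<in> dual_line (f i)})" by (rule card_UN_le[OF P(1)])
  also have "\<dots> \<le> (\<Sum>z\<in>P. k)" by (rule sum_mono) (rule deg)
  also have "\<dots> \<le> c * k" using P(2) by simp
  finally have "N \<le> c * k" by simp
  hence "m * k \<le> c * k" using N(1) by (rule order.trans[rotated])
  thus "enat m \<le> enat c" using N(2) by simp
qed

section \<open>The choice of parameters\<close>

lemma choose_le_power: "(n choose k) \<le> n ^ k"
proof -
  have "(n choose k) * 1 \<le> (n choose k) * fact k" by (intro mult_left_mono) (auto simp: fact_ge_1)
  also have "\<dots> \<le> n ^ k" by (rule binomial_fact_pow)
  finally show ?thesis by simp
qed

text \<open>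
  This is one term of the exponential series of \<open>m\<close>, with \<open>exp 1 \<le> 3\<close>.
\<close>

lemma power_self_le_fact: "real m ^ m \<le> 3 ^ m * fact m"
proof -
  have "(\<Sum>i\<in>{m}. inverse (fact i) * real m ^ i) \<le> (\<Sum>i. inverse (fact i) * real m ^ i)"
    by (intro sum_le_suminf summable_exp) auto
  also have "\<dots> = exp (real m)" by (simp add: exp_def divide_inverse)
  also have "\<dots> = exp 1 ^ m" by (simp flip: exp_of_nat_mult)
  also have "\<dots> \<le> 3 ^ m" by (intro power_mono exp_le) auto
  finally show ?thesis by (simp add: field_simps)
qed

lemma choose_le_power_div:
  assumes "0 < m" shows "real (n choose m) \<le> (3 * real n / real m) ^ m"
proof -
  have "real (n choose m) * real m ^ m \<le> real (n choose m) * (3 ^ m * fact m)"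
    by (intro mult_left_mono power_self_le_fact) auto
  also have "\<dots> = 3 ^ m * real ((n choose m) * fact m)" by simp
  also have "\<dots> \<le> 3 ^ m * real (n ^ m)"
    by (intro mult_left_mono of_nat_mono binomial_fact_pow) auto
  finally show ?thesis using assms by (simp add: power_divide power_mult_distrib field_simps)
qed

text \<open>
  All parameters are powers of \<open>h\<close>, where \<open>s\<close> is a large constant. In terms of \<open>N = h ^ (5 * s)\<close>,
  the width \<open>K = h ^ s\<close> is \<open>N powr (1 / 5)\<close> and \<open>B / N = h\<^sup>2\<close> is a small power of \<open>N\<close>. There are
  \<open>J = B / K\<close> slopes, the largest number for which \<open>2 * B\<close> intercepts suffice, and \<open>J\<close> is
  also the threshold for \<open>p\<close>. The degree bound \<open>D\<close> is the square root of \<open>J\<close>, which balances the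
  two contributions \<open>K * B / D\<close> and about \<open>D * K * B / J\<close> times a constant to the number of positive
  answers.
\<close>

proposition hadwiger_debrunner_ge_power:
  assumes s: "1 \<le> s" and h: "20 \<le> h" "6 * s + 3 \<le> h" "h ^ (17 * (6 * s + 3)) \<le> 2 ^ h"
    and p: "h ^ (4 * s + 2) \<le> p"
  shows "enat (h ^ (5 * s - 1)) \<le> hadwiger_debrunner TYPE(real ^ 2) p 3"
proof -
  define K B J D N q k where
    defs: "K = h ^ s" "B = h ^ (5 * s + 2)" "J = h ^ (4 * s + 2)" "D = h ^ (2 * s + 1)"
      "N = h ^ (5 * s)" "q = 17 * h ^ (4 * s + 1)" "k = 6 * s + 3"
  define V where "V = grid K B"
  have n: "card V = h ^ (6 * s + 2)"
    unfolding V_def card_grid defs by (simp add: power_add[symmetric])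
  have V: "finite V" "V \<noteq> {}"
    using h n by (auto simp: V_def finite_grid)
  have pos: "0 < K" "0 < B" "0 < J" "0 < D" "0 < N" using h by (auto simp: defs)
  have JK: "J * K = B" by (simp add: defs power_add[symmetric])
  have "K * 4 \<le> K * h" using h by simp
  hence "D * K * 4 \<le> D * (K * h)" by (simp add: mult.assoc)
  also have "\<dots> \<le> J"
    unfolding defs power_Suc2[symmetric] power_add[symmetric] using h s by (intro power_increasing) auto
  finally have DK: "D * K * 4 \<le> J" .
  \<comment> \<open>Supersaturation gives J / 2 triples per vertex, of which the spoilt ones cost at most half.\<close>
  interpret dense_triple_system V "grid_collinear J" "8 * B" D K "real J / 4"
    unfolding V_def
  proof (rule grid_dense_triple_system)
    have "real (D * K * 4) \<le> real J" using DK by (rule of_nat_mono)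
    thus "real J / 4 + real D * real K \<le> real J / 2" by simp
  qed (use JK pos in auto)
  \<comment> \<open>The factor 17 in q is 1 for the first summand plus 16 for the second.\<close>
  have "card V / D + 2 * (D + K) * card V / (real J / 4) \<le> real q"
  proof -
    have "K \<le> D" unfolding defs using h by (intro power_increasing) auto
    hence "2 * (D + K) * card V \<le> 4 * D * card V" by simp
    hence "2 * (D + K) * card V / (real J / 4) \<le> (4 * D * card V) / (real J / 4)"
      using pos by (intro divide_right_mono of_nat_mono) auto
    also have "4 * D * card V = 4 * h ^ (4 * s + 1) * J"
      unfolding n defs by (simp add: power_add[symmetric])
    also have "real (4 * h ^ (4 * s + 1) * J) / (real J / 4) = 16 * h ^ (4 * s + 1)"
      using pos by simp
    finally have "2 * (D + K) * card V / (real J / 4) \<le> 16 * h ^ (4 * s + 1)" .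
    moreover have "card V = h ^ (4 * s + 1) * D" unfolding n defs by (simp add: power_add[symmetric])
    hence "card V / D = h ^ (4 * s + 1)" using pos by simp
    ultimately show ?thesis by (simp add: defs)
  qed
  from containers[OF this] obtain \<C> where C: "finite \<C>" "card \<C> \<le> (card V + 1) ^ q"
      "\<And>C. C \<in> \<C> \<Longrightarrow> C \<subseteq> V \<and> card C \<le> 8 * B + q"
      "\<And>I. I \<subseteq> V \<Longrightarrow> independent I \<Longrightarrow> \<exists>C\<in>\<C>. I \<subseteq> C"
    by auto
  have "q \<le> h * h ^ (4 * s + 1)" using h by (simp add: defs)
  also have "\<dots> \<le> B"
    unfolding defs power_Suc[symmetric] using h s by (intro power_increasing) auto
  finally have C9: "C \<subseteq> V \<and> card C \<le> 9 * B" if "C \<in> \<C>" for C using C(3)[OF that] by simp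
  \<comment> \<open>Pencils with a single member need separate treatment, because that point may be
    sampled many times; the singletons are therefore added.\<close>
  define \<L> where "\<L> = {L \<in> range (pencil V). 2 \<le> card L} \<union> (\<lambda>v. {v}) ` V"
  have finL: "finite \<L>" unfolding \<L>_def using card_pencils(1)[OF V(1)] V(1) by blast
  have "card \<L> \<le> card {L \<in> range (pencil V). 2 \<le> card L} + card ((\<lambda>v. {v}) ` V)"
    unfolding \<L>_def by (rule card_Un_le)
  also have "\<dots> \<le> card V ^ 2 + card V"
    by (intro add_mono card_pencils(2)[OF V(1)] card_image_le V(1))
  also have "\<dots> \<le> 2 * card V ^ 2" by (simp add: power2_eq_square)
  finally have cL: "card \<L> \<le> 2 * card V ^ 2" .
  have L: "L \<subseteq> V \<and> card L \<le> K" if "L \<in> \<L>" for L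
    using that pos card_pencil[of K B] by (auto simp: \<L>_def V_def pencil_def)
  define x where "x = real h"
  have x: "20 \<le> x" using h by (simp add: x_def)
  have x2: "400 \<le> x ^ 2" using power_mono[OF x, of 2] by simp
  have "card \<C> * ((N choose J) * ((9 * B) / card V) ^ J) \<le> 1 / 4"
  proof -
    have "1 \<le> card V" using V by (simp add: Suc_le_eq card_gt_0_iff)
    hence "card V + 1 \<le> 2 * card V" by simp
    also have "\<dots> \<le> h * card V" using h by (intro mult_right_mono) auto
    also have "\<dots> = h ^ (6 * s + 3)" unfolding n by (simp add: eval_nat_numeral)
    finally have "card V + 1 \<le> h ^ (6 * s + 3)" .
    hence "(card V + 1) ^ q \<le> (h ^ (6 * s + 3)) ^ q" by (rule power_mono) simp
    also have "\<dots> = (h ^ (17 * (6 * s + 3))) ^ (h ^ (4 * s + 1))"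
      unfolding defs by (simp only: power_mult[symmetric] ac_simps)
    \<comment> \<open>The spare factor h of J over the exponent q absorbs the logarithm of card V.\<close>
    also have "\<dots> \<le> (2 ^ h) ^ (h ^ (4 * s + 1))" by (intro power_mono h) simp
    also have "\<dots> = 2 ^ J" by (simp add: defs power_mult[symmetric])
    finally have "card \<C> \<le> 2 ^ J" using C(2) by linarith
    hence "real (card \<C>) \<le> real (2 ^ J)" by (rule of_nat_mono)
    hence "card \<C> * ((N choose J) * ((9 * B) / card V) ^ J)
        \<le> 2 ^ J * ((3 * real N / J) ^ J * ((9 * B) / card V) ^ J)"
      using pos by (intro mult_mono choose_le_power_div) auto
    also have "\<dots> = (2 * (3 * real N / J * ((9 * B) / card V))) ^ J" by (simp only: power_mult_distrib)
    also have "2 * (3 * real N / J * ((9 * B) / card V)) = 54 / x ^ 2"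
    proof -
      have "N * B * h ^ 2 = J * card V" unfolding n defs by (simp add: power_add[symmetric])
      hence "real (N * B * h ^ 2) = real (J * card V)" by (rule arg_cong)
      thus ?thesis using pos n x x_def by (simp add: field_simps)
    qed
    also have "(54 / x ^ 2) ^ J \<le> (54 / x ^ 2) ^ 1"
      using pos x2 by (intro power_decreasing) (auto simp: divide_le_eq)
    also have "\<dots> \<le> 1 / 4" using x2 by (simp add: divide_le_eq)
    finally show ?thesis .
  qed
  moreover have "card \<L> * ((N choose k) * (K / card V) ^ k) \<le> 1 / 4"
  proof -
    have "real (card \<L>) \<le> real (2 * card V ^ 2)" using cL by (rule of_nat_mono)
    moreover have "real (N choose k) \<le> real (N ^ k)" by (rule of_nat_mono) (rule choose_le_power)
    ultimately have "card \<L> * ((N choose k) * (K / card V) ^ k) \<le> real (2 * card V ^ 2) * (real (N ^ k) * (K / card V) ^ k)"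
      by (intro mult_mono) auto
    also have "\<dots> = 2 * card V ^ 2 * (N * K / card V) ^ k" by (simp add: power_divide power_mult_distrib)
    also have "N * K / card V = 1 / x ^ 2"
    proof -
      have "N * K * h ^ 2 = card V" unfolding n defs by (simp add: power_add[symmetric])
      hence "real (N * K * h ^ 2) = real (card V)" by (rule arg_cong)
      thus ?thesis using pos n x x_def by (simp add: field_simps)
    qed
    also have "2 * card V ^ 2 * (1 / x ^ 2) ^ k = 2 / x ^ 2"
    proof -
      have "(6 * s + 2) * 2 + 2 = 2 * (6 * s + 3)" by simp
      hence "card V ^ 2 * h ^ 2 = (h ^ 2) ^ k"
        unfolding n defs by (simp only: power_add[symmetric] power_mult[symmetric])
      hence "real (card V ^ 2 * h ^ 2) = real ((h ^ 2) ^ k)" by (rule arg_cong)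
      hence "real (card V) ^ 2 * x ^ 2 = (x ^ 2) ^ k" by (simp add: x_def)
      thus ?thesis using x by (simp add: field_simps)
    qed
    also have "\<dots> \<le> 1 / 4" using x2 by (simp add: divide_le_eq)
    finally show ?thesis .
  qed
  ultimately obtain f where f: "f \<in> {..<N} \<rightarrow> V"
      "\<And>C. C \<in> \<C> \<Longrightarrow> card {i. i < N \<and> f i \<in> C} < J"
      "\<And>L. L \<in> \<L> \<Longrightarrow> card {i. i < N \<and> f i \<in> L} < k"
    using sample_avoiding_two_families[OF V C(1) C9 finL L, of N J k] by force
  show ?thesis
  proof (rule hadwiger_debrunner_ge)
    have "h ^ (5 * s - 1) * k \<le> h ^ (5 * s - 1) * h" using h by (simp add: defs)
    also have "\<dots> = N" unfolding defs power_Suc2[symmetric] using s by simp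
    finally show "h ^ (5 * s - 1) * k \<le> N" .
    show "0 < k" by (simp add: defs)
  next
    fix S assume S: "S \<subseteq> f ` {..<N}" "p \<le> card S"
    have "\<not> independent S"
    proof
      assume "independent S"
      moreover have "S \<subseteq> V" using S(1) funcset_image[OF f(1)] by (rule order.trans)
      ultimately obtain C where CC: "C \<in> \<C>" "S \<subseteq> C" using C(4) by blast
      have "S \<subseteq> f ` {i. i < N \<and> f i \<in> C}"
      proof
        fix v assume v: "v \<in> S"
        then obtain i where "i < N" "v = f i" using S(1) by blast
        thus "v \<in> f ` {i. i < N \<and> f i \<in> C}" using v CC(2) by blast
      qed
      hence "card S \<le> card {i. i < N \<and> f i \<in> C}" by (intro surj_card_le) auto
      thus False using f(2)[OF CC(1)] S(2) p by (simp add: defs)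
    qed
    thus "\<exists>x\<in>S. \<exists>y\<in>S. \<exists>z\<in>S. grid_collinear J x y z" by (auto simp: independent_def)
  next
    fix z
    have "{i. i < N \<and> z \<in> dual_line (f i)} = {i. i < N \<and> f i \<in> pencil V z}"
      using f(1) by (auto simp: pencil_def)
    also have "card \<dots> \<le> k"
    proof (cases "pencil V z = {}")
      case False
      have "finite (pencil V z)" using V(1) by (simp add: pencil_def)
      have "\<exists>L\<in>\<L>. pencil V z \<subseteq> L"
      proof (cases "2 \<le> card (pencil V z)")
        case True thus ?thesis by (auto simp: \<L>_def)
      next
        case False
        moreover have "0 < card (pencil V z)"
          using \<open>pencil V z \<noteq> {}\<close> \<open>finite (pencil V z)\<close> by (simp add: card_gt_0_iff)
        ultimately have "card (pencil V z) = 1" by linarith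
        then obtain v where "pencil V z = {v}" by (auto simp: card_1_singleton_iff)
        moreover from this have "v \<in> V" by (auto simp: pencil_def)
        ultimately show ?thesis by (auto simp: \<L>_def)
      qed
      then obtain L where L: "L \<in> \<L>" "pencil V z \<subseteq> L" by blast
      have "card {i. i < N \<and> f i \<in> pencil V z} \<le> card {i. i < N \<and> f i \<in> L}"
        using L by (intro card_mono) auto
      thus ?thesis using f(3)[OF L(1)] by simp
    qed simp
    finally show "card {i. i < N \<and> z \<in> dual_line (f i)} \<le> k" .
  qed
qed

lemma between_consecutive_powers:
  fixes p :: nat
  assumes "H ^ e \<le> p" "0 < e"
  shows "\<exists>h\<ge>H. h ^ e \<le> p \<and> p < Suc h ^ e"
proof (rule ccontr)
  assume neg: "\<not> ?thesis"
  have "h \<ge> H \<Longrightarrow> h ^ e \<le> p" for h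
    by (induction h rule: dec_induct) (use assms neg in \<open>auto simp: not_less\<close>)
  from this[of "H + Suc p"] have "(H + Suc p) ^ e \<le> p" by simp
  moreover have "(H + Suc p) ^ 1 \<le> (H + Suc p) ^ e" using assms by (intro power_increasing) auto
  ultimately show False by simp
qed

theorem corollary1:
  "\<exists>c::real. c > 0 \<and> (\<forall>\<epsilon>::real. \<epsilon> > 0 \<longrightarrow>
     (\<exists>p0::nat. \<forall>p\<ge>p0.
        ereal_of_enat (hadwiger_debrunner TYPE(real ^ 2) p 3) \<ge> ereal (c * real p powr (5 / 4 - \<epsilon>))))"
proof (rule exI[of _ 1], intro conjI allI impI)
  fix \<epsilon> :: real assume \<epsilon>: "\<epsilon> > 0"
  \<comment> \<open>The piercing number is at least h ^ (5 s - 1), while p is less than (h + 1) ^ (4 s + 2),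
    hence at most h ^ (4 s + 3) for large h. The quotient of the exponents tends to 5 / 4, and it
    is at least 5 / 4 - \<epsilon> once s is at least 2 / \<epsilon>.\<close>
  define s where "s = Suc (nat \<lceil>2 / \<epsilon>\<rceil>)"
  have "2 / \<epsilon> \<le> real s" unfolding s_def by linarith
  hence "2 \<le> s * \<epsilon>" using \<epsilon> by (simp add: field_simps)
  moreover have "(4 * s + 3) * (5 / 4 - \<epsilon>) = 5 * s + 15 / 4 - 4 * (s * \<epsilon>) - 3 * \<epsilon>"
    by (simp add: algebra_simps)
  ultimately have exps: "(4 * s + 3) * (5 / 4 - \<epsilon>) \<le> 5 * real s - 1" using \<epsilon> by linarith
  define a where "a = 17 * (6 * s + 3)"
  have "\<forall>\<^sub>F h in sequentially. real h ^ a \<le> 2 ^ h"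
  proof -
    have "(\<lambda>h. real h powr real a / 2 ^ h) \<longlonglongrightarrow> 0" by real_asymp
    hence "\<forall>\<^sub>F h in sequentially. real h powr real a / 2 ^ h < 1" by (rule order_tendstoD) simp
    thus ?thesis
      using eventually_gt_at_top[of 0] by eventually_elim (simp add: powr_realpow field_simps)
  qed
  hence "\<forall>\<^sub>F h in sequentially. h ^ a \<le> 2 ^ h"
    by eventually_elim (metis of_nat_le_iff of_nat_numeral of_nat_power)
  hence "\<forall>\<^sub>F h in sequentially. h ^ a \<le> 2 ^ h \<and> 20 + (6 * s + 3) + 2 ^ (4 * s + 2) \<le> h"
    using eventually_ge_at_top by (rule eventually_conj)
  then obtain H where H: "\<And>h. h \<ge> H \<Longrightarrow> h ^ a \<le> 2 ^ h \<and> 20 + (6 * s + 3) + 2 ^ (4 * s + 2) \<le> h"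
    by (auto simp: eventually_sequentially)
  show "\<exists>p0::nat. \<forall>p\<ge>p0.
        ereal_of_enat (hadwiger_debrunner TYPE(real ^ 2) p 3) \<ge> ereal (1 * real p powr (5 / 4 - \<epsilon>))"
  proof (intro exI[of _ "H ^ (4 * s + 2)"] allI impI)
    fix p assume "H ^ (4 * s + 2) \<le> p"
    then obtain h where h: "H \<le> h" "h ^ (4 * s + 2) \<le> p" "p < Suc h ^ (4 * s + 2)"
      using between_consecutive_powers by (metis add_gr_0 zero_less_numeral)
    note large = H[OF h(1)]
    have s1: "1 \<le> s" by (simp add: s_def)
    have bound: "enat (h ^ (5 * s - 1)) \<le> hadwiger_debrunner TYPE(real ^ 2) p 3"
      using large h s1 by (intro hadwiger_debrunner_ge_power) (auto simp: a_def)
    have "p \<le> Suc h ^ (4 * s + 2)" using h by simp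
    also have "\<dots> \<le> (2 * h) ^ (4 * s + 2)" using large by (intro power_mono) auto
    also have "\<dots> = 2 ^ (4 * s + 2) * h ^ (4 * s + 2)" by (rule power_mult_distrib)
    also have "\<dots> \<le> h * h ^ (4 * s + 2)" using large by (intro mult_right_mono) auto
    also have "\<dots> = h ^ (4 * s + 3)" by (simp add: eval_nat_numeral)
    finally have p: "p \<le> h ^ (4 * s + 3)" .
    have h1: "1 \<le> real h" using large by simp
    have "1 \<le> h ^ (4 * s + 2)" using large by (intro one_le_power) simp
    hence "1 \<le> p" using h(2) by (rule order.trans)
    hence p1: "1 \<le> real p" by simp
    have "real p powr (5 / 4 - \<epsilon>) \<le> real (h ^ (5 * s - 1))"
    proof (cases "0 \<le> 5 / 4 - \<epsilon>")
      case True
      have "real p powr (5 / 4 - \<epsilon>) \<le> real (h ^ (4 * s + 3)) powr (5 / 4 - \<epsilon>)"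
        using True p1 p by (intro powr_mono2 of_nat_mono) auto
      also have "real (h ^ (4 * s + 3)) = real h powr (4 * s + 3)"
        using h1 powr_realpow[of "real h" "4 * s + 3"] by simp
      also have "(real h powr (4 * s + 3)) powr (5 / 4 - \<epsilon>) = real h powr ((4 * s + 3) * (5 / 4 - \<epsilon>))"
        by (simp add: powr_powr)
      also have "\<dots> \<le> real h powr (5 * real s - 1)" using exps h1 by (intro powr_mono) auto
      also have "5 * real s - 1 = real (5 * s - 1)" using s1 by (simp add: of_nat_diff)
      also have "real h powr real (5 * s - 1) = real (h ^ (5 * s - 1))"
        using h1 powr_realpow[of "real h" "5 * s - 1"] by simp
      finally show ?thesis .
    next
      case False
      hence "real p powr (5 / 4 - \<epsilon>) \<le> real p powr 0" using p1 by (intro powr_mono) auto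
      also have "\<dots> \<le> real h ^ (5 * s - 1)" using p1 h1 by (simp add: one_le_power)
      finally show ?thesis by simp
    qed
    hence "ereal (1 * real p powr (5 / 4 - \<epsilon>)) \<le> ereal_of_enat (enat (h ^ (5 * s - 1)))" by simp
    also have "\<dots> \<le> ereal_of_enat (hadwiger_debrunner TYPE(real ^ 2) p 3)"
      using bound by (simp only: ereal_of_enat_le_iff)
    finally show "ereal (1 * real p powr (5 / 4 - \<epsilon>)) \<le> ereal_of_enat (hadwiger_debrunner TYPE(real ^ 2) p 3)" .
  qed
qed simp

end
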